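(* Let $k\ge 1$ be an integer and let $S_{k,k}$ be the symmetric double star graph with central vertices $u$ and $v$ (the two vertices of degree $k+1$). Then either (a) $1+4k$ is not a perfect square and there is pretty good state transfer from $u$ to $v$, or (b) $1+4k$ is a perfect square and there is no pretty good state transfer from $u$ to $v$.
   Context: Graphs are finite, simple and undirected. $S_{k,k}$ is the graph obtained from two disjoint copies of the star $K_{1,k}$ by joining the two centers (of degree $k$) by a new edge; the two central vertices have degree $k+1$ and all others have degree one. Let $A$ be the adjacency matrix of a graph and $U(t)=\exp(itA)$ for $t\in\mathbb{R}$; $e_a$ denotes the standard basis vector indexed by the vertex $a$. For distinct vertices $a,b$ there is pretty good state transfer from $a$ to $b$ if there is a complex number $\gamma$ (necessarily $|\gamma|=1$) such that for each real $\epsilon>0$ there is a time $t\in\mathbb{R}$ with $\|U(t)e_a-\gamma e_b\|<\epsilon$. *)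

theory Defs
  imports
    "HOL-Analysis.L2_Norm"
    "HOL-Computational_Algebra.Nth_Powers"
    "Graph_Theory.Pair_Digraph"
    "Jordan_Normal_Form.Matrix"
begin

text \<open>
  Finite simple undirected graphs are the symmetric loop-free pair digraphs
  (\<^locale>\<open>pair_graph\<close>): an undirected edge between a and b is represented by
  the two arcs (a, b) and (b, a).
\<close>

definition is_star :: "nat \<Rightarrow> 'a pair_pre_digraph \<Rightarrow> 'a \<Rightarrow> bool" where
  "is_star k S c \<longleftrightarrow>
     (\<exists>L. finite L \<and> card L = k \<and> c \<notin> L \<and>
          S = \<lparr> pverts = insert c L, parcs = {c} \<times> L \<union> L \<times> {c} \<rparr>)"

definition is_sym_double_star :: "nat \<Rightarrow> 'a pair_pre_digraph \<Rightarrow> 'a \<Rightarrow> 'a \<Rightarrow> bool" where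
  "is_sym_double_star k G u v \<longleftrightarrow>
     (\<exists>S T. is_star k S u \<and> is_star k T v \<and> pverts S \<inter> pverts T = {} \<and>
            G = \<lparr> pverts = pverts S \<union> pverts T,
                  parcs = parcs S \<union> parcs T \<union> {(u, v), (v, u)} \<rparr>)"

lemma is_sym_double_starE:
  assumes "is_sym_double_star k G u v"
  obtains L M where "finite L" "finite M" "card L = k" "card M = k" "u \<noteq> v"
    "u \<notin> L" "u \<notin> M" "v \<notin> L" "v \<notin> M" "L \<inter> M = {}"
    "pverts G = insert u L \<union> insert v M"
    "parcs G = {u} \<times> L \<union> L \<times> {u} \<union> ({v} \<times> M \<union> M \<times> {v}) \<union> {(u, v), (v, u)}"
proof -
  obtain S T where ST: "is_star k S u" "is_star k T v" "pverts S \<inter> pverts T = {}"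
    and G: "G = \<lparr> pverts = pverts S \<union> pverts T, parcs = parcs S \<union> parcs T \<union> {(u, v), (v, u)} \<rparr>"
    using assms unfolding is_sym_double_star_def by blast
  obtain L where L: "finite L" "card L = k" "u \<notin> L"
    and S: "S = \<lparr> pverts = insert u L, parcs = {u} \<times> L \<union> L \<times> {u} \<rparr>"
    using ST(1) unfolding is_star_def by blast
  obtain M where M: "finite M" "card M = k" "v \<notin> M"
    and T: "T = \<lparr> pverts = insert v M, parcs = {v} \<times> M \<union> M \<times> {v} \<rparr>"
    using ST(2) unfolding is_star_def by blast
  have disj: "insert u L \<inter> insert v M = {}"
    using ST(3) by (simp add: S T)
  have V: "pverts G = insert u L \<union> insert v M"
    by (simp add: G S T)
  have E: "parcs G = {u} \<times> L \<union> L \<times> {u} \<union> ({v} \<times> M \<union> M \<times> {v}) \<union> {(u, v), (v, u)}"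
    by (simp add: G S T)
  show thesis
    using L M disj V E by (intro that[of L M]) auto
qed

lemma is_sym_double_star_pair_graph:
  assumes "is_sym_double_star k G u v"
  shows "pair_graph G"
proof -
  obtain L M where *: "finite L" "finite M" "u \<noteq> v" "u \<notin> L" "v \<notin> M"
    and V: "pverts G = insert u L \<union> insert v M"
    and E: "parcs G = {u} \<times> L \<union> L \<times> {u} \<union> ({v} \<times> M \<union> M \<times> {v}) \<union> {(u, v), (v, u)}"
    by (rule is_sym_double_starE[OF assms]) (rule that; assumption)
  have fin: "finite (pverts G)" using * V by simp
  have sub: "parcs G \<subseteq> pverts G \<times> pverts G"
  proof (rule subrelI)
    fix a b assume "(a, b) \<in> parcs G"
    then show "(a, b) \<in> pverts G \<times> pverts G" unfolding E V by blast
  qed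
  have irr: "a \<noteq> b" if "(a, b) \<in> parcs G" for a b
    using that * unfolding E by blast
  have sym: "sym (parcs G)"
    unfolding sym_def E by blast
  show ?thesis
  proof
    show "fst e \<in> pverts G" "snd e \<in> pverts G" if "e \<in> parcs G" for e
      using sub that by auto
    show "finite (pverts G)" by (rule fin)
    show "finite (parcs G)" using finite_subset[OF sub] fin by simp
    show "fst e \<noteq> snd e" if "e \<in> parcs G" for e
      using irr that by (cases e) simp
    show "symmetric (with_proj G)" using sym by (simp add: symmetric_def)
  qed
qed

lemma is_sym_double_star_out_degree:
  assumes "is_sym_double_star k G u v"
  shows "u \<noteq> v" "out_degree (with_proj G) u = k + 1" "out_degree (with_proj G) v = k + 1"
    and "\<And>w. w \<in> pverts G - {u, v} \<Longrightarrow> out_degree (with_proj G) w = 1"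
proof -
  obtain L M where *: "finite L" "finite M" "card L = k" "card M = k" "u \<noteq> v"
      "u \<notin> L" "u \<notin> M" "v \<notin> L" "v \<notin> M" "L \<inter> M = {}"
    and V: "pverts G = insert u L \<union> insert v M"
    and E: "parcs G = {u} \<times> L \<union> L \<times> {u} \<union> ({v} \<times> M \<union> M \<times> {v}) \<union> {(u, v), (v, u)}"
    by (rule is_sym_double_starE[OF assms]) (rule that; assumption)
  have deg: "out_degree (with_proj G) w = card {b. (w, b) \<in> parcs G}" for w
  proof -
    have "out_arcs (with_proj G) w = Pair w ` {b. (w, b) \<in> parcs G}"
      by (auto simp: out_arcs_def)
    then show ?thesis by (simp add: out_degree_def card_image inj_on_def)
  qed
  show "u \<noteq> v" by (rule *(5))
  have "{b. (u, b) \<in> parcs G} = insert v L" "{b. (v, b) \<in> parcs G} = insert u M"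
    unfolding E using * by blast+
  then show "out_degree (with_proj G) u = k + 1" "out_degree (with_proj G) v = k + 1"
    using * by (simp_all add: deg)
  fix w assume "w \<in> pverts G - {u, v}"
  then consider "w \<in> L" "w \<notin> M" "w \<noteq> u" "w \<noteq> v" | "w \<in> M" "w \<notin> L" "w \<noteq> u" "w \<noteq> v"
    unfolding V using * by blast
  then show "out_degree (with_proj G) w = 1"
  proof cases
    case 1
    then have "{b. (w, b) \<in> parcs G} = {u}" unfolding E by blast
    then show ?thesis by (simp add: deg)
  next
    case 2
    then have "{b. (w, b) \<in> parcs G} = {v}" unfolding E by blast
    then show ?thesis by (simp add: deg)
  qed
qed

lemma ex_is_sym_double_star:
  "\<exists>G. is_sym_double_star k G 0 1 \<and> pverts G = {0..<2 * k + 2}"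
proof -
  define S :: "nat pair_pre_digraph" where "S = \<lparr> pverts = insert 0 {2..<k + 2},
    parcs = {0} \<times> {2..<k + 2} \<union> {2..<k + 2} \<times> {0} \<rparr>"
  define T :: "nat pair_pre_digraph" where "T = \<lparr> pverts = insert 1 {k + 2..<2 * k + 2},
    parcs = {1} \<times> {k + 2..<2 * k + 2} \<union> {k + 2..<2 * k + 2} \<times> {1} \<rparr>"
  define G where "G = \<lparr> pverts = pverts S \<union> pverts T,
    parcs = parcs S \<union> parcs T \<union> {(0, 1), (1, 0)} \<rparr>"
  have "is_star k S 0"
    unfolding is_star_def by (rule exI[of _ "{2..<k + 2}"]) (simp add: S_def)
  moreover have "is_star k T 1"
    unfolding is_star_def by (rule exI[of _ "{k + 2..<2 * k + 2}"]) (simp add: T_def)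
  moreover have "pverts S \<inter> pverts T = {}"
    by (auto simp: S_def T_def)
  ultimately have "is_sym_double_star k G 0 1"
    unfolding is_sym_double_star_def G_def by blast
  moreover have "pverts G = {0..<2 * k + 2}"
    by (auto simp: G_def S_def T_def)
  ultimately show ?thesis by blast
qed

text \<open>
  Matrices are indexed by initial segments of the naturals, so the following notions are
  meant for graphs G whose vertex set is {0..<card (pverts G)}.
\<close>

definition adjacency_matrix :: "nat pair_pre_digraph \<Rightarrow> complex mat" where
  "adjacency_matrix G =
     mat (card (pverts G)) (card (pverts G)) (\<lambda>(i, j). of_bool ((i, j) \<in> parcs G))"

text \<open>The matrix exponential of a square matrix, its power series being summed entrywise.\<close>

definition mat_exp :: "complex mat \<Rightarrow> complex mat" where
  "mat_exp M = mat (dim_row M) (dim_col M) (\<lambda>(i, j). \<Sum>m. (M ^\<^sub>m m) $$ (i, j) / fact m)"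

definition transition_matrix :: "nat pair_pre_digraph \<Rightarrow> real \<Rightarrow> complex mat" where
  "transition_matrix G t = mat_exp ((\<i> * complex_of_real t) \<cdot>\<^sub>m adjacency_matrix G)"

definition euclidean_norm_vec :: "complex vec \<Rightarrow> real" where
  "euclidean_norm_vec x = L2_set (\<lambda>i. cmod (x $ i)) {..<dim_vec x}"

definition pretty_good_state_transfer :: "nat pair_pre_digraph \<Rightarrow> nat \<Rightarrow> nat \<Rightarrow> bool" where
  "pretty_good_state_transfer G a b \<longleftrightarrow>
     (\<exists>\<gamma>::complex. \<forall>\<epsilon>::real. \<epsilon> > 0 \<longrightarrow> (\<exists>t::real.
        euclidean_norm_vec
          (transition_matrix G t *\<^sub>v unit_vec (card (pverts G)) a
             - \<gamma> \<cdot>\<^sub>v unit_vec (card (pverts G)) b) < \<epsilon>))"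

end

theory Submission
  imports Defs "HOL-Analysis.Kronecker_Approximation_Theorem"
begin

text \<open>
  The adjacency matrix acts on \<open>e\<^sub>u\<close> through the four eigenvalues \<open>\<plusminus>\<alpha>, \<plusminus>\<beta>\<close>, where
  \<open>\<alpha>, \<beta> = (1 \<plusminus> d) / 2\<close> are the roots of \<open>x\<^sup>2 - x - k\<close> and \<open>d = sqrt (1 + 4k)\<close>; hence \<open>U(t) e\<^sub>u\<close>
  is explicit. If \<open>d\<close> is irrational, restrict to times \<open>t = (2j + 1) \<pi>\<close>: since \<open>\<alpha> + \<beta> = 1\<close>, the
  state depends only on \<open>\<alpha>t\<close> modulo \<open>2\<pi>\<close> and equals \<open>\<i> e\<^sub>v\<close> if \<open>\<alpha>t = \<pi>/2\<close>, a value approached by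
  Kronecker's theorem. If \<open>d = 2r + 1\<close>, put \<open>z = exp(it)\<close>; for the amplitudes at \<open>u\<close> and at the leaves
  to be small, \<open>z\<close> must be close to a common solution of \<open>z ^ (2r + 1) = 1\<close> and \<open>z ^ (2r + 2) = -1\<close>;
  but then \<open>z = -1\<close>, which contradicts the first equation.
\<close>

section \<open>Rational square roots of natural numbers\<close>

text \<open>For a fraction \<open>p / q\<close> in lowest terms, \<open>q\<^sup>2\<close> divides
  \<open>p\<^sup>2\<close>, and coprimality forces \<open>q = 1\<close>. The contrapositive turns
  the arithmetic condition on \<open>1 + 4 * k\<close> into the irrationality that the approximation
  argument requires.\<close>

lemma sqrt_of_nat_rat_imp_is_square:
  assumes "sqrt (real n) \<in> \<rat>"
  shows "is_square n"
proof -
  obtain p q where q: "q \<noteq> 0" and eq: "\<bar>sqrt (real n)\<bar> = real p / real q" and "coprime p q"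
    using Rats_abs_nat_div_natE[OF assms] by metis
  have "real n = (real p / real q)\<^sup>2"
    using eq by (metis of_nat_0_le_iff power2_abs real_sqrt_pow2)
  then have "real (n * q\<^sup>2) = real (p\<^sup>2)"
    using q by (simp add: field_simps)
  then have "n * q\<^sup>2 = p\<^sup>2"
    using of_nat_eq_iff by blast
  then have "q\<^sup>2 dvd p\<^sup>2"
    by (metis dvd_triv_right)
  then have "q = 1"
    using \<open>coprime p q\<close> by (metis coprime_absorb_right coprime_power_left_iff coprime_power_right_iff
        is_unit_power_iff nat_dvd_1_iff_1 pos2 less_numeral_extra(3))
  then have "n = p ^ 2"
    using \<open>n * q\<^sup>2 = p\<^sup>2\<close> by simp
  then show ?thesis
    by (rule is_nth_powerI)
qed

section \<open>The matrix exponential on a sum of eigenvectors\<close>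

text \<open>Once \<open>unit_vec n u\<close> is written as a sum of vectors \<open>E i\<close> on
  which \<open>X\<close> acts as the scalar \<open>ev i\<close>, every power of \<open>X\<close>,
  and hence the exponential series, acts on each summand by scalars. This avoids diagonalizing all
  of \<open>X\<close>.\<close>

lemma mat_exp_mult_unit_vec:
  fixes X :: "complex mat" and E :: "'i \<Rightarrow> nat \<Rightarrow> complex"
  assumes X: "X \<in> carrier_mat n n"
    and eigen: "\<And>i w. i \<in> I \<Longrightarrow> w < n \<Longrightarrow> (\<Sum>j<n. X $$ (w, j) * E i j) = ev i * E i w"
    and decomp: "\<And>w. w < n \<Longrightarrow> (\<Sum>i\<in>I. E i w) = of_bool (w = u)"
    and u: "u < n" and w: "w < n"
  shows "(mat_exp X *\<^sub>v unit_vec n u) $ w = (\<Sum>i\<in>I. exp (ev i) * E i w)"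
proof -
  have pow_carrier: "X ^\<^sub>m m \<in> carrier_mat n n" for m
    using X by simp
  have pow_eigen: "(\<Sum>j<n. (X ^\<^sub>m m) $$ (w, j) * E i j) = ev i ^ m * E i w" if "i \<in> I" for i m
  proof (induction m)
    case 0
    have "(\<Sum>j<n. (X ^\<^sub>m 0) $$ (w, j) * E i j) = (\<Sum>j<n. if w = j then E i j else 0)"
      using X w by (intro sum.cong) auto
    then show ?case using w by simp
  next
    case (Suc m)
    have "(X ^\<^sub>m Suc m) $$ (w, j) = (\<Sum>l<n. (X ^\<^sub>m m) $$ (w, l) * X $$ (l, j))" if "j < n" for j
      using that w X pow_carrier[of m] by (simp add: scalar_prod_def lessThan_atLeast0)
    then have "(\<Sum>j<n. (X ^\<^sub>m Suc m) $$ (w, j) * E i j)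
        = (\<Sum>j<n. \<Sum>l<n. (X ^\<^sub>m m) $$ (w, l) * X $$ (l, j) * E i j)"
      by (intro sum.cong) (simp_all add: sum_distrib_right)
    also have "\<dots> = (\<Sum>l<n. (X ^\<^sub>m m) $$ (w, l) * (\<Sum>j<n. X $$ (l, j) * E i j))"
      by (subst sum.swap) (simp add: sum_distrib_left mult.assoc)
    also have "\<dots> = ev i * (\<Sum>l<n. (X ^\<^sub>m m) $$ (w, l) * E i l)"
      unfolding sum_distrib_left[of "ev i"]
      using \<open>i \<in> I\<close> by (intro sum.cong) (simp_all add: eigen)
    finally show ?case using Suc.IH by simp
  qed
  have pow: "(X ^\<^sub>m m) $$ (w, u) = (\<Sum>i\<in>I. ev i ^ m * E i w)" for m
  proof -
    \<comment> \<open>Column \<open>u\<close> of the power is its product with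
      \<open>unit_vec n u\<close>, which \<open>decomp\<close> replaces by the sum of the
      \<open>E i\<close>.\<close>
    have "(X ^\<^sub>m m) $$ (w, u) = (\<Sum>j<n. (X ^\<^sub>m m) $$ (w, j) * (\<Sum>i\<in>I. E i j))"
      using u by (simp add: decomp)
    also have "\<dots> = (\<Sum>i\<in>I. \<Sum>j<n. (X ^\<^sub>m m) $$ (w, j) * E i j)"
      by (simp add: sum_distrib_left) (rule sum.swap)
    finally show ?thesis by (simp add: pow_eigen)
  qed
  \<comment> \<open>The entrywise series in \<open>mat_exp\<close> is determined only once it is
    known to converge; its convergence is inherited from the scalar exponential series.\<close>
  have "(\<lambda>m. \<Sum>i\<in>I. ev i ^ m /\<^sub>R fact m * E i w) sums (\<Sum>i\<in>I. exp (ev i) * E i w)"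
    by (intro sums_sum sums_mult2 exp_converges)
  also have "(\<lambda>m. \<Sum>i\<in>I. ev i ^ m /\<^sub>R fact m * E i w) = (\<lambda>m. (X ^\<^sub>m m) $$ (w, u) / fact m)"
    by (simp add: pow sum_distrib_left scaleR_conv_of_real divide_inverse mult_ac)
  finally have "mat_exp X $$ (w, u) = (\<Sum>i\<in>I. exp (ev i) * E i w)"
    using X u w by (simp add: mat_exp_def sums_iff)
  then show ?thesis
    using X u w by (simp add: mat_exp_def)
qed

section \<open>The evolution of \<open>unit_vec n u\<close> on the double star\<close>

text \<open>Vectors constant on \<open>L\<close> and on \<open>M\<close> form an invariant space of
  the adjacency matrix. It splits by the sign \<open>s\<close> under exchange of the two stars and
  by the sign \<open>q\<close> of the root \<open>(1 + q * d) / 2\<close>. Changing \<open>s\<close>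
  negates the eigenvalue: components even in \<open>s\<close> (at \<open>u\<close> and on
  \<open>M\<close>) give cosines, those odd in \<open>s\<close> (at \<open>v\<close> and on
  \<open>L\<close>) give \<open>\<i>\<close> times sines.\<close>

lemma sym_double_star_state:
  fixes G :: "nat pair_pre_digraph"
  assumes G: "is_sym_double_star k G u v" and V: "pverts G = {0..<card (pverts G)}"
  defines "d \<equiv> sqrt (1 + 4 * real k)"
  defines "\<alpha> \<equiv> (1 + d) / 2" and "\<beta> \<equiv> (1 - d) / 2"
  obtains L M where "card L = k" "card M = k" "u \<noteq> v" "pverts G = {u, v} \<union> L \<union> M"
    "\<And>t. (transition_matrix G t *\<^sub>v unit_vec (card (pverts G)) u) $ u
       = of_real ((\<alpha> * cos (\<alpha> * t) - \<beta> * cos (\<beta> * t)) / d)"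
    "\<And>t. (transition_matrix G t *\<^sub>v unit_vec (card (pverts G)) u) $ v
       = \<i> * of_real ((\<alpha> * sin (\<alpha> * t) - \<beta> * sin (\<beta> * t)) / d)"
    "\<And>t w. w \<in> L \<Longrightarrow> (transition_matrix G t *\<^sub>v unit_vec (card (pverts G)) u) $ w
       = \<i> * of_real ((sin (\<alpha> * t) - sin (\<beta> * t)) / d)"
    "\<And>t w. w \<in> M \<Longrightarrow> (transition_matrix G t *\<^sub>v unit_vec (card (pverts G)) u) $ w
       = of_real ((cos (\<alpha> * t) - cos (\<beta> * t)) / d)"
    "L \<inter> M = {}" "u \<notin> L \<union> M" "v \<notin> L \<union> M"
proof -
  obtain L M where LM: "finite L" "finite M" "card L = k" "card M = k" "u \<noteq> v"
      "u \<notin> L" "u \<notin> M" "v \<notin> L" "v \<notin> M" "L \<inter> M = {}"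
    and VG: "pverts G = insert u L \<union> insert v M"
    and EG: "parcs G = {u} \<times> L \<union> L \<times> {u} \<union> ({v} \<times> M \<union> M \<times> {v}) \<union> {(u, v), (v, u)}"
    by (rule is_sym_double_starE[OF G]) (rule that; assumption)
  define n where "n = card (pverts G)"
  define A where "A = adjacency_matrix G"
  define I :: "(real \<times> real) set" where "I = {1, -1} \<times> {1, -1}"
  define ev :: "real \<times> real \<Rightarrow> real" where "ev = (\<lambda>(s, q). s * (1 + q * d) / 2)"
  \<comment> \<open>\<open>E i\<close> is the projection of \<open>e\<^sub>u\<close> onto the eigenspace of \<open>ev i\<close>\<close>
  define E :: "real \<times> real \<Rightarrow> nat \<Rightarrow> real" where "E = (\<lambda>(s, q) w.
     if w = u then (1 + q * d) / 2 * q / (2 * d)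
     else if w = v then s * (1 + q * d) / 2 * q / (2 * d)
     else if w \<in> L then s * q / (2 * d) else q / (2 * d))"
  have d2: "d\<^sup>2 = 1 + 4 * real k"
    by (simp add: d_def)
  have d0: "d > 0"
    by (simp add: d_def add_pos_nonneg)
  have A: "A \<in> carrier_mat n n"
    by (simp add: A_def adjacency_matrix_def n_def)
  have lt: "w < n \<longleftrightarrow> w \<in> pverts G" for w
    using V unfolding n_def by (metis atLeast0LessThan lessThan_iff)
  have EL: "E (s, q) w = s * q / (2 * d)" if "w \<in> L" for s q w
    using that LM by (auto simp: E_def)
  have EM: "E (s, q) w = q / (2 * d)" if "w \<in> M" for s q w
    using that LM by (auto simp: E_def)
  have Eu: "E (s, q) u = (1 + q * d) / 2 * q / (2 * d)" for s q
    by (simp add: E_def)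
  have Ev: "E (s, q) v = s * (1 + q * d) / 2 * q / (2 * d)" for s q
    using LM by (simp add: E_def)
  have sum_A: "(\<Sum>j<n. A $$ (w, j) * complex_of_real (f j)) = of_real (sum f {j. (w, j) \<in> parcs G})"
    if "w < n" for w f
  proof -
    have "{j. (w, j) \<in> parcs G} \<subseteq> {..<n}"
      unfolding EG using lt VG by auto
    then have *: "{..<n} \<inter> {j. (w, j) \<in> parcs G} = {j. (w, j) \<in> parcs G}"
      by blast
    have "(\<Sum>j<n. A $$ (w, j) * complex_of_real (f j))
        = (\<Sum>j<n. if j \<in> {j. (w, j) \<in> parcs G} then complex_of_real (f j) else 0)"
      using that by (intro sum.cong) (auto simp: A_def adjacency_matrix_def n_def)
    also have "\<dots> = of_real (sum f {j. (w, j) \<in> parcs G})"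
      by (subst sum.inter_restrict[symmetric]) (simp_all only: finite_lessThan * of_real_sum)
    finally show ?thesis .
  qed
  have cases: "w = u \<or> w = v \<or> w \<in> L \<or> w \<in> M" if "w < n" for w
    using that lt VG by auto
  have nbrs: "{j. (u, j) \<in> parcs G} = insert v L" "{j. (v, j) \<in> parcs G} = insert u M"
    "w \<in> L \<Longrightarrow> {j. (w, j) \<in> parcs G} = {u}" "w \<in> M \<Longrightarrow> {j. (w, j) \<in> parcs G} = {v}" for w
    unfolding EG using LM by blast+
  have real_eigen: "sum (E i) {j. (w, j) \<in> parcs G} = ev i * E i w" if "i \<in> I" "w < n" for i w
  proof -
    obtain s q where i: "i = (s, q)" and s: "s * s = 1" and q: "q * q = 1"
      using \<open>i \<in> I\<close> by (auto simp: I_def)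
    have k: "real k = (d * d - 1) / 4"
      using d2 by (simp add: power2_eq_square)
    \<comment> \<open>The eigenvalue equations at the two centers reduce to this: both
      \<open>(1 + d) / 2\<close> and \<open>(1 - d) / 2\<close> satisfy
      \<open>x\<^sup>2 = x + k\<close>.\<close>
    have quad: "(1 + q * d) / 2 * ((1 + q * d) / 2) = real k + (1 + q * d) / 2"
      using q unfolding k by (simp add: field_simps) algebra
    have sumL: "sum (E i) L = real k * (s * q / (2 * d))" and sumM: "sum (E i) M = real k * (q / (2 * d))"
      using LM by (simp_all add: i EL EM)
    have "sum (E i) (insert v L) = ev i * E i u"
    proof -
      have "sum (E i) (insert v L) = s * (real k + (1 + q * d) / 2) * q / (2 * d)"
        using LM by (simp add: sumL) (simp add: i Ev distrib_left distrib_right add_divide_distrib)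
      also have "\<dots> = ev i * E i u"
        unfolding quad[symmetric] by (simp add: i ev_def Eu)
      finally show ?thesis .
    qed
    moreover have "sum (E i) (insert u M) = ev i * E i v"
    proof -
      \<comment> \<open>The factor \<open>s * s\<close> is 1; it is inserted because
        \<open>ev i\<close> and \<open>E i v\<close> carry one \<open>s\<close> each.\<close>
      have "sum (E i) (insert u M) = (s * s) * (real k + (1 + q * d) / 2) * q / (2 * d)"
        using LM by (simp add: sumM s) (simp add: i Eu distrib_left distrib_right add_divide_distrib)
      also have "\<dots> = ev i * E i v"
        unfolding quad[symmetric] by (simp add: i ev_def Ev)
      finally show ?thesis .
    qed
    moreover have "E i u = ev i * E i w" if "w \<in> L"
    proof -
      have "ev i * E i w = (s * s) * ((1 + q * d) / 2 * q / (2 * d))"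
        by (simp add: i ev_def EL[OF that])
      then show ?thesis by (simp add: s) (simp add: i Eu)
    qed
    moreover have "E i v = ev i * E i w" if "w \<in> M"
      by (simp add: i ev_def Ev EM[OF that])
    ultimately show ?thesis
      using cases[OF \<open>w < n\<close>] by (auto simp: nbrs)
  qed
  \<comment> \<open>Summing over \<open>s\<close> cancels the entries at \<open>v\<close> and on
    \<open>L\<close>, summing over \<open>q\<close> those on \<open>M\<close>; at \<open>u\<close>
    the four terms add up to 1.\<close>
  have decomp: "(\<Sum>i\<in>I. E i w) = of_bool (w = u)" if "w < n" for w
    using cases[OF that] LM d0 by (auto simp: I_def sum.cartesian_product[symmetric] E_def field_simps)
  have state: "(transition_matrix G t *\<^sub>v unit_vec n u) $ w
      = (\<Sum>s\<in>{1, -1}. \<Sum>q\<in>{1, -1}. cis (t * ev (s, q)) * E (s, q) w)" if "w < n" for t w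
  proof -
    have "u < n" using lt VG by simp
    have "(mat_exp ((\<i> * of_real t) \<cdot>\<^sub>m A) *\<^sub>v unit_vec n u) $ w
        = (\<Sum>i\<in>I. exp (\<i> * of_real t * of_real (ev i)) * of_real (E i w))"
    proof (rule mat_exp_mult_unit_vec[OF _ _ _ \<open>u < n\<close> that])
      show "(\<i> * of_real t) \<cdot>\<^sub>m A \<in> carrier_mat n n" using A by simp
      fix w assume "w < n"
      show "(\<Sum>i\<in>I. complex_of_real (E i w)) = of_bool (w = u)"
        unfolding of_real_sum[symmetric] decomp[OF \<open>w < n\<close>] by simp
      fix i assume "i \<in> I"
      have "(\<Sum>j<n. ((\<i> * of_real t) \<cdot>\<^sub>m A) $$ (w, j) * complex_of_real (E i j))
          = \<i> * of_real t * (\<Sum>j<n. A $$ (w, j) * complex_of_real (E i j))"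
        using A \<open>w < n\<close> by (simp add: sum_distrib_left mult.assoc)
      then show "(\<Sum>j<n. ((\<i> * of_real t) \<cdot>\<^sub>m A) $$ (w, j) * complex_of_real (E i j))
          = \<i> * of_real t * of_real (ev i) * of_real (E i w)"
        using sum_A[OF \<open>w < n\<close>] real_eigen[OF \<open>i \<in> I\<close> \<open>w < n\<close>] by simp
    qed
    then show ?thesis
      by (simp add: transition_matrix_def A_def I_def sum.cartesian_product case_prod_beta cis_conv_exp mult.assoc)
  qed
  show thesis
  proof (rule that[of L M])
    fix t w
    have ev: "t * ev (1, 1) = \<alpha> * t" "t * ev (1, -1) = \<beta> * t"
      "t * ev (-1, 1) = - (\<alpha> * t)" "t * ev (-1, -1) = - (\<beta> * t)"
      by (simp_all add: ev_def \<alpha>_def \<beta>_def field_simps)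
    have "u < n" "v < n" using lt VG by auto
    show "(transition_matrix G t *\<^sub>v unit_vec (card (pverts G)) u) $ u
       = of_real ((\<alpha> * cos (\<alpha> * t) - \<beta> * cos (\<beta> * t)) / d)"
      unfolding n_def[symmetric] state[OF \<open>u < n\<close>] Eu
      using d0 by (simp add: ev complex_eq_iff \<alpha>_def \<beta>_def field_simps)
    show "(transition_matrix G t *\<^sub>v unit_vec (card (pverts G)) u) $ v
       = \<i> * of_real ((\<alpha> * sin (\<alpha> * t) - \<beta> * sin (\<beta> * t)) / d)"
      unfolding n_def[symmetric] state[OF \<open>v < n\<close>] Ev
      using d0 by (simp add: ev complex_eq_iff \<alpha>_def \<beta>_def field_simps)
    show "(transition_matrix G t *\<^sub>v unit_vec (card (pverts G)) u) $ w
       = \<i> * of_real ((sin (\<alpha> * t) - sin (\<beta> * t)) / d)" if "w \<in> L"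
    proof -
      have "w < n" using that lt VG by auto
      show ?thesis
        unfolding n_def[symmetric] state[OF \<open>w < n\<close>] EL[OF that]
        using d0 by (simp add: ev complex_eq_iff field_simps)
    qed
    show "(transition_matrix G t *\<^sub>v unit_vec (card (pverts G)) u) $ w
       = of_real ((cos (\<alpha> * t) - cos (\<beta> * t)) / d)" if "w \<in> M"
    proof -
      have "w < n" using that lt VG by auto
      show ?thesis
        unfolding n_def[symmetric] state[OF \<open>w < n\<close>] EM[OF that]
        using d0 by (simp add: ev complex_eq_iff field_simps)
    qed
  qed (use LM VG in auto)
qed

section \<open>Comparison of the Euclidean norm with the entries\<close>

lemma cmod_le_euclidean_norm_vec:
  assumes "i < dim_vec x"
  shows "cmod (x $ i) \<le> euclidean_norm_vec x"
  unfolding euclidean_norm_vec_def using assms by (intro member_le_L2_set) auto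

lemma euclidean_norm_vec_le:
  assumes "\<And>i. i < dim_vec x \<Longrightarrow> cmod (x $ i) \<le> c"
  shows "euclidean_norm_vec x \<le> real (dim_vec x) * c"
proof -
  have "euclidean_norm_vec x \<le> (\<Sum>i<dim_vec x. cmod (x $ i))"
    unfolding euclidean_norm_vec_def by (intro L2_set_le_sum) auto
  also have "\<dots> \<le> real (dim_vec x) * c"
    using sum_bounded_above[of "{..<dim_vec x}" "\<lambda>i. cmod (x $ i)" c] assms by simp
  finally show ?thesis .
qed

section \<open>Pretty good state transfer in the irrational case\<close>

lemma sym_double_star_pgst:
  assumes G: "is_sym_double_star k G u v" and V: "pverts G = {0..<card (pverts G)}"
    and irr: "sqrt (1 + 4 * real k) \<notin> \<rat>"
  shows "pretty_good_state_transfer G u v"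
  unfolding pretty_good_state_transfer_def
\<comment> \<open>The phase is \<open>\<i>\<close>: when both sines equal 1, the amplitude at
  \<open>v\<close> is \<open>\<i>\<close> times \<open>(\<alpha> - \<beta>) / d = 1\<close>.\<close>
proof (intro exI[of _ \<i>] allI impI)
  fix \<epsilon> :: real assume "\<epsilon> > 0"
  define d where "d = sqrt (1 + 4 * real k)"
  define \<alpha> where "\<alpha> = (1 + d) / 2"
  define \<beta> where "\<beta> = (1 - d) / 2"
  define n where "n = card (pverts G)"
  obtain L M where LM: "card L = k" "card M = k" "u \<noteq> v" "pverts G = {u, v} \<union> L \<union> M"
    and state:
    "\<And>t. (transition_matrix G t *\<^sub>v unit_vec n u) $ u
       = of_real ((\<alpha> * cos (\<alpha> * t) - \<beta> * cos (\<beta> * t)) / d)"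
    "\<And>t. (transition_matrix G t *\<^sub>v unit_vec n u) $ v
       = \<i> * of_real ((\<alpha> * sin (\<alpha> * t) - \<beta> * sin (\<beta> * t)) / d)"
    "\<And>t w. w \<in> L \<Longrightarrow> (transition_matrix G t *\<^sub>v unit_vec n u) $ w
       = \<i> * of_real ((sin (\<alpha> * t) - sin (\<beta> * t)) / d)"
    "\<And>t w. w \<in> M \<Longrightarrow> (transition_matrix G t *\<^sub>v unit_vec n u) $ w
       = of_real ((cos (\<alpha> * t) - cos (\<beta> * t)) / d)"
    and disj: "L \<inter> M = {}" "u \<notin> L \<union> M" "v \<notin> L \<union> M"
    by (rule sym_double_star_state[OF G V, folded d_def, folded \<alpha>_def \<beta>_def n_def]) (rule that; assumption)
  have lt: "w < n \<longleftrightarrow> w \<in> pverts G" for w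
    using V unfolding n_def by (metis atLeast0LessThan lessThan_iff)
  have "n > 0" using lt[of u] LM by auto
  have d1: "d \<ge> 1" by (simp add: d_def)
  have \<alpha>_irr: "\<alpha> \<notin> \<rat>"
  proof
    assume "\<alpha> \<in> \<rat>"
    then have "2 * \<alpha> - 1 \<in> \<rat>"
      by (intro Rats_diff Rats_mult Rats_number_of Rats_1)
    moreover have "2 * \<alpha> - 1 = d"
      by (simp add: \<alpha>_def field_simps)
    ultimately show False
      using irr by (simp add: d_def)
  qed
  have sum: "\<alpha> + \<beta> = 1" and diff: "\<alpha> - \<beta> = d"
    by (simp_all add: \<alpha>_def \<beta>_def field_simps)
  \<comment> \<open>Each of the \<open>n\<close> entries will be at most
    \<open>2 * \<delta>\<close>, so the norm is at most two thirds of
    \<open>\<epsilon>\<close>.\<close>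
  define \<delta> where "\<delta> = \<epsilon> / (3 * real n)"
  have "\<delta> > 0" using \<open>\<epsilon> > 0\<close> \<open>n > 0\<close> by (simp add: \<delta>_def)
  then have "\<delta> / (2 * pi) > 0" by simp
  \<comment> \<open>With \<open>t = (2j + 1) * pi\<close>, the goal that \<open>\<alpha> * t\<close>
    be near \<open>pi / 2\<close> modulo \<open>2 * pi\<close> becomes, after division by
    \<open>2 * pi\<close>, that \<open>j * \<alpha>\<close> be near \<open>1/4 - \<alpha>/2\<close>
    modulo 1.\<close>
  obtain h j where hj: "\<bar>of_int j * \<alpha> - of_int h - (1/4 - \<alpha>/2)\<bar> < \<delta> / (2 * pi)"
    using sequence_of_fractional_parts_is_dense[OF \<alpha>_irr \<open>\<delta> / (2 * pi) > 0\<close>, of "1/4 - \<alpha>/2"]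
    by metis
  define t where "t = pi + 2 * pi * of_int j"
  define x where "x = \<alpha> * t - pi / 2 - 2 * pi * of_int h"
  have "x = 2 * pi * (of_int j * \<alpha> - of_int h - (1/4 - \<alpha>/2))"
    by (simp add: x_def t_def algebra_simps)
  then have x: "\<bar>x\<bar> < \<delta>"
    using hj by (simp add: abs_mult pos_less_divide_eq mult.commute)
  have at: "\<alpha> * t = x + pi / 2 + 2 * pi * of_int h"
    by (simp add: x_def)
  have bt: "\<beta> * t = pi - \<alpha> * t + 2 * pi * of_int j"
  proof -
    have "\<beta> = 1 - \<alpha>" using sum by simp
    then have "\<beta> * t = t - \<alpha> * t" by (simp only: left_diff_distrib mult_1_left)
    then show ?thesis using t_def by linarith
  qed
  have per: "sin (y + 2 * pi * of_int i) = sin y" "cos (y + 2 * pi * of_int i) = cos y" for y i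
    by (simp_all add: sin_add cos_add mult.assoc[symmetric] sin_int_2pin cos_int_2pin)
  have cos_a: "cos (\<alpha> * t) = - sin x" and sin_a: "sin (\<alpha> * t) = cos x"
    unfolding at per by (simp_all add: sin_add cos_add)
  have cos_b: "cos (\<beta> * t) = sin x" and sin_b: "sin (\<beta> * t) = cos x"
    unfolding bt per by (simp_all add: cos_a sin_a)
  have sin_x: "\<bar>sin x\<bar> < \<delta>"
    using abs_sin_x_le_abs_x[of x] x by simp
  have cos_x: "\<bar>1 - cos x\<bar> \<le> \<delta>"
  proof -
    have "1 - cos x = 2 * (sin (x / 2))\<^sup>2"
      using cos_double_sin[of "x / 2"] by simp
    also have "\<dots> \<le> 2 * \<bar>sin (x / 2)\<bar>"
      using power_decreasing[of 1 2 "\<bar>sin (x / 2)\<bar>"] by simp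
    also have "\<dots> \<le> \<bar>x\<bar>"
      using abs_sin_x_le_abs_x[of "x / 2"] by simp
    finally show ?thesis using x by simp
  qed
  let ?y = "transition_matrix G t *\<^sub>v unit_vec n u - \<i> \<cdot>\<^sub>v unit_vec n v"
  have dim: "dim_vec (transition_matrix G t *\<^sub>v unit_vec n u) = n" "dim_vec ?y = n"
    by (simp_all add: transition_matrix_def mat_exp_def adjacency_matrix_def n_def)
  have small: "\<bar>sin x / d\<bar> \<le> \<delta>"
  proof -
    have "\<bar>sin x / d\<bar> \<le> \<bar>sin x\<bar>" using d1 by (simp add: divide_le_eq mult_le_cancel_left1)
    then show ?thesis using sin_x by simp
  qed
  \<comment> \<open>The largest bound occurs on \<open>M\<close>, where the two cosines are opposite
    and their difference doubles; on \<open>L\<close> the sines agree and the entry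
    vanishes.\<close>
  have "cmod (?y $ w) \<le> 2 * \<delta>" if "w < n" for w
  proof -
    have "v < n" using lt LM by simp
    then have y: "?y $ w = (transition_matrix G t *\<^sub>v unit_vec n u) $ w - \<i> * of_bool (w = v)"
      using that dim by simp
    have "w \<in> {u, v} \<union> L \<union> M"
      using that unfolding lt LM(4) .
    then consider "w = u" | "w = v" | "w \<in> L" | "w \<in> M"
      by blast
    then show ?thesis
    proof cases
      case 1
      have "\<alpha> * cos (\<alpha> * t) - \<beta> * cos (\<beta> * t) = - ((\<alpha> + \<beta>) * sin x)"
        unfolding cos_a cos_b by (simp add: distrib_right)
      then have "?y $ w = of_real (- (sin x / d))"
        unfolding 1 y[unfolded 1] state(1) using LM sum by simp
      then show ?thesis using small \<open>\<delta> > 0\<close> by (simp only: norm_of_real abs_minus_cancel)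
    next
      case 2
      have "\<alpha> * sin (\<alpha> * t) - \<beta> * sin (\<beta> * t) = (\<alpha> - \<beta>) * cos x"
        unfolding sin_a sin_b left_diff_distrib ..
      then have "(\<alpha> * sin (\<alpha> * t) - \<beta> * sin (\<beta> * t)) / d = cos x"
        using d1 diff by simp
      then have "?y $ w = - \<i> * of_real (1 - cos x)"
        unfolding 2 y[unfolded 2] state(2) by (simp add: algebra_simps)
      then have "cmod (?y $ w) = \<bar>1 - cos x\<bar>"
        by (simp only: norm_mult norm_of_real norm_minus_cancel norm_ii mult_1_left)
      then show ?thesis using cos_x \<open>\<delta> > 0\<close> by linarith
    next
      case 3
      then have "w \<noteq> v" using disj by auto
      then have "?y $ w = 0"
        unfolding y state(3)[OF 3] sin_a sin_b by simp
      then show ?thesis using \<open>\<delta> > 0\<close> by simp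
    next
      case 4
      then have "w \<noteq> v" using disj by auto
      have "(cos (\<alpha> * t) - cos (\<beta> * t)) / d = - 2 * (sin x / d)"
        by (simp add: cos_a cos_b)
      then have "?y $ w = of_real (- 2 * (sin x / d))"
        unfolding y state(4)[OF 4] using \<open>w \<noteq> v\<close> by simp
      then show ?thesis using small by (simp only: norm_of_real abs_mult)
    qed
  qed
  then have "euclidean_norm_vec ?y \<le> real n * (2 * \<delta>)"
    using euclidean_norm_vec_le[of ?y "2 * \<delta>"] dim by simp
  also have "\<dots> < \<epsilon>"
    using \<open>n > 0\<close> \<open>\<epsilon> > 0\<close> by (simp add: \<delta>_def)
  finally show "\<exists>t. euclidean_norm_vec (transition_matrix G t *\<^sub>v unit_vec (card (pverts G)) u
      - \<i> \<cdot>\<^sub>v unit_vec (card (pverts G)) v) < \<epsilon>"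
    unfolding n_def by blast
qed

section \<open>No state transfer in the perfect square case\<close>

text \<open>Quantitative incompatibility of \<open>z ^ (2 * r + 1) = 1\<close> and
  \<open>z ^ (2 * r + 2) = -1\<close>. Comparing the two powers puts \<open>z\<close> within
  \<open>2 * c\<close> of -1; raising to the odd power \<open>2 * r + 1\<close> multiplies this
  error by at most the exponent. So one power is near both -1 and 1, which are 2 apart, whence
  \<open>2 \<le> (4r + 3) * c\<close>, rounded up in the conclusion.\<close>

lemma cmod_consecutive_powers_gap:
  fixes z :: complex
  assumes z: "cmod z = 1" and c: "c \<ge> 0"
    and 1: "cmod (z ^ (2 * r + 1) - 1) \<le> c" and 2: "cmod (z ^ (2 * r + 2) + 1) \<le> c"
  shows "1 \<le> (2 * real r + 2) * c"
proof -
  have "z + 1 = (z ^ (2 * r + 2) + 1) - z * (z ^ (2 * r + 1) - 1)"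
    by (simp add: algebra_simps)
  then have "cmod (z + 1) \<le> cmod (z ^ (2 * r + 2) + 1) + cmod (z * (z ^ (2 * r + 1) - 1))"
    by (metis norm_triangle_ineq4)
  also have "\<dots> \<le> 2 * c"
    using 1 2 z by (simp add: norm_mult)
  finally have "cmod (z - (-1)) \<le> 2 * c"
    by simp
  moreover have "cmod (z ^ (2 * r + 1) - (-1) ^ (2 * r + 1)) \<le> real (2 * r + 1) * cmod (z - (-1))"
    using z by (intro norm_power_diff) auto
  ultimately have "cmod (z ^ (2 * r + 1) + 1) \<le> real (2 * r + 1) * (2 * c)"
    by (smt (verit) mult_left_mono of_nat_0_le_iff diff_minus_eq_add minus_one_power_iff
        even_add even_mult_iff even_numeral odd_one)
  moreover have "2 \<le> cmod (z ^ (2 * r + 1) + 1) + cmod (z ^ (2 * r + 1) - 1)"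
    using norm_triangle_ineq4[of "z ^ (2 * r + 1) + 1" "z ^ (2 * r + 1) - 1"] by simp
  ultimately have "2 \<le> real (2 * r + 1) * (2 * c) + c"
    using 1 by linarith
  then show ?thesis using c by (simp add: algebra_simps)
qed

lemma sym_double_star_not_pgst:
  assumes k: "k \<ge> 1" and G: "is_sym_double_star k G u v" and V: "pverts G = {0..<card (pverts G)}"
    and sq: "is_square (1 + 4 * k)"
  shows "\<not> pretty_good_state_transfer G u v"
proof
  assume "pretty_good_state_transfer G u v"
  then obtain \<gamma> where pgst: "\<And>\<epsilon>. \<epsilon> > 0 \<Longrightarrow> \<exists>t. euclidean_norm_vec
      (transition_matrix G t *\<^sub>v unit_vec (card (pverts G)) u
        - \<gamma> \<cdot>\<^sub>v unit_vec (card (pverts G)) v) < \<epsilon>"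
    unfolding pretty_good_state_transfer_def by blast
  obtain s where s: "1 + 4 * k = s\<^sup>2"
    using sq by (elim is_nth_powerE)
  \<comment> \<open>Oddness of the root \<open>s\<close> makes the eigenvalues
    \<open>(1 + s) / 2\<close> and \<open>(1 - s) / 2\<close> the integers \<open>r + 1\<close> and
    \<open>-r\<close>.\<close>
  have "odd (s\<^sup>2)"
    unfolding s[symmetric] by simp
  then obtain r where r: "s = 2 * r + 1"
    by (auto elim: oddE)
  define d where "d = sqrt (1 + 4 * real k)"
  define \<alpha> where "\<alpha> = (1 + d) / 2"
  define \<beta> where "\<beta> = (1 - d) / 2"
  define n where "n = card (pverts G)"
  obtain L M where LM: "card L = k" "card M = k" "u \<noteq> v" "pverts G = {u, v} \<union> L \<union> M"
    and state:
    "\<And>t. (transition_matrix G t *\<^sub>v unit_vec n u) $ u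
       = of_real ((\<alpha> * cos (\<alpha> * t) - \<beta> * cos (\<beta> * t)) / d)"
    "\<And>t. (transition_matrix G t *\<^sub>v unit_vec n u) $ v
       = \<i> * of_real ((\<alpha> * sin (\<alpha> * t) - \<beta> * sin (\<beta> * t)) / d)"
    "\<And>t w. w \<in> L \<Longrightarrow> (transition_matrix G t *\<^sub>v unit_vec n u) $ w
       = \<i> * of_real ((sin (\<alpha> * t) - sin (\<beta> * t)) / d)"
    "\<And>t w. w \<in> M \<Longrightarrow> (transition_matrix G t *\<^sub>v unit_vec n u) $ w
       = of_real ((cos (\<alpha> * t) - cos (\<beta> * t)) / d)"
    and disj: "L \<inter> M = {}" "u \<notin> L \<union> M" "v \<notin> L \<union> M"
    by (rule sym_double_star_state[OF G V, folded d_def, folded \<alpha>_def \<beta>_def n_def]) (rule that; assumption)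
  have lt: "w < n \<longleftrightarrow> w \<in> pverts G" for w
    using V unfolding n_def by (metis atLeast0LessThan lessThan_iff)
  have "1 + 4 * real k = (real s)\<^sup>2"
    using s by (metis of_nat_1 of_nat_add of_nat_mult of_nat_numeral of_nat_power)
  then have d: "d = 2 * real r + 1"
    by (simp add: d_def r)
  have \<alpha>: "\<alpha> = real (r + 1)" and \<beta>: "\<beta> = - real r"
    by (simp_all add: \<alpha>_def \<beta>_def d)
  \<comment> \<open>With this \<open>c\<close> the gap bound \<open>(2 * r + 2) * c\<close> is
    \<open>1 / 2\<close>, contradicting its being at least 1. The choice of
    \<open>\<epsilon>\<close> clears the denominator \<open>d\<close> of the amplitudes and leaves
    \<open>c / 2\<close>.\<close>
  define c where "c = 1 / (4 * (real r + 1))"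
  define \<epsilon> where "\<epsilon> = c / (2 * d)"
  have "c > 0" by (simp add: c_def)
  have "d > 0" by (simp add: d)
  have "\<epsilon> > 0" using \<open>c > 0\<close> \<open>d > 0\<close> by (simp add: \<epsilon>_def)
  have \<epsilon>d: "\<epsilon> * d = c / 2" using \<open>d > 0\<close> by (simp add: \<epsilon>_def)
  obtain t where t: "euclidean_norm_vec
      (transition_matrix G t *\<^sub>v unit_vec n u - \<gamma> \<cdot>\<^sub>v unit_vec n v) < \<epsilon>"
    using pgst[OF \<open>\<epsilon> > 0\<close>] unfolding n_def by blast
  let ?y = "transition_matrix G t *\<^sub>v unit_vec n u"
  have dim: "dim_vec (?y - \<gamma> \<cdot>\<^sub>v unit_vec n v) = n"
    by (simp add: transition_matrix_def mat_exp_def adjacency_matrix_def n_def)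
  \<comment> \<open>Entries away from \<open>v\<close> do not involve \<open>\<gamma>\<close>, so
    their smallness excludes every phase at once.\<close>
  have small: "cmod (?y $ w) < \<epsilon>" if "w < n" "w \<noteq> v" for w
  proof -
    have "v < n" using lt LM by simp
    have "cmod ((?y - \<gamma> \<cdot>\<^sub>v unit_vec n v) $ w) < \<epsilon>"
      using cmod_le_euclidean_norm_vec[of w "?y - \<gamma> \<cdot>\<^sub>v unit_vec n v"] t that dim by simp
    then show ?thesis using that \<open>v < n\<close> by simp
  qed
  \<comment> \<open>Since \<open>k\<close> is positive, each star has a leaf; \<open>l\<close>
    controls the sine difference and \<open>m\<close> the cosine difference.\<close>
  obtain l m where lm: "l \<in> L" "m \<in> M"
    using k LM by (metis card.empty ex_in_conv not_one_le_zero)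
  have "cmod (?y $ u) < \<epsilon>" "cmod (?y $ l) < \<epsilon>" "cmod (?y $ m) < \<epsilon>"
    using lm disj LM by (auto intro!: small simp: lt)
  then have bounds: "\<bar>\<alpha> * cos (\<alpha> * t) - \<beta> * cos (\<beta> * t)\<bar> < c / 2"
    "\<bar>sin (\<alpha> * t) - sin (\<beta> * t)\<bar> < c / 2" "\<bar>cos (\<alpha> * t) - cos (\<beta> * t)\<bar> < c / 2"
    using lm \<open>d > 0\<close> unfolding \<epsilon>d[symmetric] state(1) state(3)[OF lm(1)] state(4)[OF lm(2)]
    by (simp_all add: norm_mult norm_divide pos_divide_less_eq flip: of_real_mult of_real_diff)
  define z where "z = cis t"
  have za: "z ^ (r + 1) = cis (\<alpha> * t)" and zb: "cnj (z ^ r) = cis (\<beta> * t)"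
    by (simp_all only: z_def \<alpha> \<beta> Complex.DeMoivre cis_cnj mult_minus_left)
  have z1: "cmod z = 1" by (simp add: z_def)
  have unit: "z ^ i * cnj (z ^ i) = 1" for i
    unfolding complex_norm_square[symmetric] by (simp add: norm_power z1)
  have "cmod (z ^ (2 * r + 1) - 1) \<le> c"
  proof -
    \<comment> \<open>Multiplying by the unit \<open>z ^ r\<close> turns
      \<open>cis (\<alpha> * t) - cis (\<beta> * t)\<close> into this difference, because
      \<open>\<alpha> - \<beta> = 2 * r + 1\<close>.\<close>
    have "z ^ (2 * r + 1) - 1 = z ^ r * (z ^ (r + 1) - cnj (z ^ r))"
      unfolding right_diff_distrib unit by (simp add: power_add[symmetric] mult_2)
    then have "cmod (z ^ (2 * r + 1) - 1) = cmod (cis (\<alpha> * t) - cis (\<beta> * t))"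
      by (simp only: za zb norm_mult norm_power z1) simp
    also have "\<dots> \<le> \<bar>cos (\<alpha> * t) - cos (\<beta> * t)\<bar> + \<bar>sin (\<alpha> * t) - sin (\<beta> * t)\<bar>"
      using cmod_le[of "cis (\<alpha> * t) - cis (\<beta> * t)"] by simp
    finally show ?thesis using bounds by linarith
  qed
  moreover have "cmod (z ^ (2 * r + 2) + 1) \<le> c"
  proof -
    have "z ^ (2 * r + 2) + 1 = z ^ (r + 1) * (z ^ (r + 1) + cnj (z ^ (r + 1)))"
      unfolding distrib_left unit by (simp add: power_add[symmetric] mult_2)
    also have "z ^ (r + 1) + cnj (z ^ (r + 1)) = of_real (2 * cos (\<alpha> * t))"
      unfolding complex_add_cnj by (simp only: za) simp
    finally have "cmod (z ^ (2 * r + 2) + 1) = 2 * \<bar>cos (\<alpha> * t)\<bar>"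
      by (simp only: norm_mult norm_power z1 norm_of_real) simp
    also have "\<dots> \<le> c"
    proof -
      \<comment> \<open>With \<open>x\<close> and \<open>y\<close> the two cosines, this isolates
        \<open>cos (\<alpha> * t)\<close> from the amplitude at \<open>u\<close> and a multiple of
        the one on \<open>M\<close>, both small.\<close>
      have "x * d = (\<alpha> * x - \<beta> * y) + real r * (x - y)" for x y
        unfolding \<alpha> \<beta> d by (simp add: algebra_simps)
      then have "cos (\<alpha> * t) * d
          = (\<alpha> * cos (\<alpha> * t) - \<beta> * cos (\<beta> * t)) + real r * (cos (\<alpha> * t) - cos (\<beta> * t))"
        by blast
      then have "\<bar>cos (\<alpha> * t) * d\<bar>
          \<le> \<bar>\<alpha> * cos (\<alpha> * t) - \<beta> * cos (\<beta> * t)\<bar> + real r * \<bar>cos (\<alpha> * t) - cos (\<beta> * t)\<bar>"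
        using abs_triangle_ineq[of "\<alpha> * cos (\<alpha> * t) - \<beta> * cos (\<beta> * t)"
          "real r * (cos (\<alpha> * t) - cos (\<beta> * t))"]
        by (simp only: abs_mult abs_of_nat)
      also have "\<dots> \<le> c / 2 + real r * (c / 2)"
        using bounds by (intro add_mono mult_left_mono) auto
      also have "\<dots> \<le> c / 2 * d"
        using \<open>c > 0\<close> by (simp add: d algebra_simps)
      finally show ?thesis
        using \<open>d > 0\<close> by (simp add: abs_mult)
    qed
    finally show ?thesis .
  qed
  ultimately have "1 \<le> (2 * real r + 2) * c"
    using cmod_consecutive_powers_gap[OF z1, of c r] \<open>c > 0\<close> by simp
  also have "\<dots> = 1 / 2"
    by (simp add: c_def field_simps)
  finally show False by simp
qed

theorem theorem5p3:
  fixes k :: nat and G :: "nat pair_pre_digraph" and u v :: nat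
  assumes "k \<ge> 1"
    and "is_sym_double_star k G u v"
    and "pverts G = {0..<card (pverts G)}"
  shows "(\<not> is_square (1 + 4 * k) \<and> pretty_good_state_transfer G u v) \<or>
         (is_square (1 + 4 * k) \<and> \<not> pretty_good_state_transfer G u v)"
proof (cases "is_square (1 + 4 * k)")
  case True
  then show ?thesis using sym_double_star_not_pgst[OF assms] by blast
next
  case False
  then have "sqrt (1 + 4 * real k) \<notin> \<rat>"
    using sqrt_of_nat_rat_imp_is_square[of "1 + 4 * k"] by auto
  then show ?thesis
    using False sym_double_star_pgst[OF assms(2,3)] by blast
qed

end
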